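(* Let $\gamma>0$ be fixed, and for a distribution $F$ let $G$ be the distribution with tail $\overline G(x)=1$ for $x<0$ and $\overline G(x)=\overline F(x)e^{-\gamma x}$ for $x\ge0$. If $F$ belongs to the class $\mathcal{S}_f\setminus\mathcal{S}^*$, then $G\notin\mathcal{J}$.
   Context: All distributions are probability distributions $F$ with unbounded support contained in $[0,\infty)$; $\overline F:=1-F$ is the tail and $F^{*2}=F*F$ the two-fold convolution. $g\sim h$ means $g(x)/h(x)\to1$ as $x\to\infty$. Class $\mathcal{J}$: $F\in\mathcal{J}$ iff, for i.i.d. $X_1,X_2,\dots$ with distribution $F$, $S_n=\sum_{i=1}^n X_i$ and $X_{n,1}=\max_{1\le i\le n}X_i$, one has for all $n\ge2$ (equivalently, for $n=2$) $\lim_{K\to\infty}\liminf_{x\to\infty}\mathbb{P}(X_{n,1}>x-K\mid S_n>x)=1$. Class $\mathcal{S}$ (subexponential): $\overline{F^{*2}}(x)\sim2\overline F(x)$. $\mathcal{S}_f$ is the class of distributions in $\mathcal{S}$ with finite mean. Class $\mathcal{K}$ (heavy-tailed): $\int_0^\infty e^{\lambda y}F(dy)=\infty$ for all $\lambda>0$. Class $\mathcal{S}^*$ (strongly subexponential): $F\in\mathcal{K}$, $F$ has finite mean $\mu>0$, and $\limsup_{x\to\infty}\frac{1}{\overline F(x)}\int_0^x\overline F(x-y)\overline F(y)\,dy=2\mu$. *)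

theory Defs
  imports "HOL-Probability.Probability" "HOL-Library.Landau_Symbols"
begin

definition support :: "real measure \<Rightarrow> real set" where
  "support F = {x. \<forall>U. open U \<longrightarrow> x \<in> U \<longrightarrow> measure F U > 0}"

definition distributions :: "real measure set" where
  "distributions = {F. real_distribution F \<and> support F \<subseteq> {0..} \<and> \<not> bounded (support F)}"

definition tail :: "real measure \<Rightarrow> real \<Rightarrow> real" where
  "tail F x = 1 - cdf F x"

text \<open>
  The i.i.d. variables \<open>X\<^sub>1, \<dots>, X\<^sub>n\<close> with distribution \<open>F\<close> are realised as the coordinates of
  the \<open>n\<close>-fold product space; the events below depend only on their joint law. The lower limit is
  taken in the extended reals, since \<^const>\<open>Liminf\<close> requires a complete lattice.
\<close>

definition class_J :: "real measure set" where
  "class_J = {F \<in> distributions. \<forall>n\<ge>2.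
     ((\<lambda>K::real. Liminf at_top (\<lambda>x::real. ereal
         (cond_prob (\<Pi>\<^sub>M i\<in>{1..n::nat}. F)
            (\<lambda>X. Max (X ` {1..n}) > x - K)
            (\<lambda>X. (\<Sum>i=1..n. X i) > x))))
       \<longlongrightarrow> 1) at_top}"

definition class_S :: "real measure set" where
  "class_S = {F \<in> distributions. tail (F \<star> F) \<sim>[at_top] (\<lambda>x. 2 * tail F x)}"

definition finite_mean :: "real measure \<Rightarrow> bool" where
  "finite_mean F \<longleftrightarrow> integrable F (\<lambda>x. x)"

definition mean :: "real measure \<Rightarrow> real" where
  "mean F = (LINT x|F. x)"

definition class_S_f :: "real measure set" where
  "class_S_f = {F \<in> class_S. finite_mean F}"

definition class_K :: "real measure set" where
  "class_K = {F \<in> distributions.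
     \<forall>l>0. (\<integral>\<^sup>+y\<in>{0..}. ennreal (exp (l * y)) \<partial>F) = \<infinity>}"

definition class_S_star :: "real measure set" where
  "class_S_star = {F \<in> class_K. finite_mean F \<and> mean F > 0 \<and>
     Limsup at_top (\<lambda>x::real. ereal
         ((1 / tail F x) * (LBINT y:{0..x}. tail F (x - y) * tail F y)))
       = ereal (2 * mean F)}"

lemma null_outside_support:
  assumes "real_distribution F"
  shows "measure F (- support F) = 0" "support F \<in> sets borel"
proof -
  interpret real_distribution F by fact
  define \<U> where "\<U> = {U::real set. open U \<and> measure F U = 0}"
  have eq: "- support F = \<Union>\<U>"
    unfolding support_def \<U>_def by (auto simp: zero_less_measure_iff)
  obtain \<V> where V: "\<V> \<subseteq> \<U>" "countable \<V>" "\<Union>\<V> = \<Union>\<U>"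
    using Lindelof[of \<U>] unfolding \<U>_def by blast
  have "(\<Union>U\<in>\<V>. U) \<in> null_sets F"
    using V by (intro null_sets_UN') (auto simp: \<U>_def null_sets_def emeasure_eq_measure)
  then show "measure F (- support F) = 0"
    using V(3) eq by (auto simp: null_sets_def measure_def)
  have "open (- support F)" unfolding eq \<U>_def by auto
  then show "support F \<in> sets borel" by (simp add: closed_def)
qed

lemma tail_eq_measure: "real_distribution F \<Longrightarrow> tail F x = measure F {x<..}"
proof -
  assume "real_distribution F"
  then interpret real_distribution F .
  show ?thesis
    using prob_compl[of "{..x}"] by (simp add: tail_def cdf_def Compl_eq_Diff_UNIV[symmetric])
qed

lemma distributions_iff:
  "F \<in> distributions \<longleftrightarrow>
     real_distribution F \<and> measure F {..<0} = 0 \<and> (\<forall>x. tail F x > 0)"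
proof (cases "real_distribution F")
  case True
  then interpret real_distribution F .
  note null = null_outside_support[OF True]
  have a: "support F \<subseteq> {0..} \<longleftrightarrow> measure F {..<0} = 0"
  proof
    assume "support F \<subseteq> {0..}"
    then have "{..<0} \<subseteq> - support F" by auto
    then have "measure F {..<0} \<le> measure F (- support F)"
      using null(2) by (intro finite_measure_mono) auto
    then show "measure F {..<0} = 0" using null(1) by (simp add: measure_le_0_iff)
  next
    assume "measure F {..<0} = 0"
    then show "support F \<subseteq> {0..}"
      unfolding support_def
      by (force simp: not_less dest!: spec[of _ "{..<0::real}"])
  qed
  have b: "\<not> bounded (support F) \<longleftrightarrow> (\<forall>x. tail F x > 0)" if s: "support F \<subseteq> {0..}"
  proof
    assume nb: "\<not> bounded (support F)"
    show "\<forall>x. tail F x > 0"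
    proof
      fix x
      have "\<not> support F \<subseteq> {0..x}" using nb bounded_subset[OF bounded_closed_interval] by blast
      then obtain s where "s \<in> support F" "s \<in> {x<..}" using s by force
      then show "tail F x > 0"
        unfolding tail_eq_measure[OF True] support_def using open_greaterThan by blast
    qed
  next
    assume t: "\<forall>x. tail F x > 0"
    show "\<not> bounded (support F)"
    proof
      assume "bounded (support F)"
      then obtain B where "\<And>s. s \<in> support F \<Longrightarrow> \<bar>s\<bar> \<le> B" by (auto simp: bounded_iff)
      then have "{B<..} \<subseteq> - support F" by fastforce
      then have "measure F {B<..} \<le> measure F (- support F)"
        using null(2) by (intro finite_measure_mono) auto
      then show False using null(1) t tail_eq_measure[OF True, of B] by (metis not_less)
    qed
  qed
  show ?thesis using True a b by (auto simp: distributions_def)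
qed (auto simp: distributions_def)

text \<open>
  The distribution \<open>G\<close> is determined by prescribing its tail; the following shows that such a
  distribution exists and is unique.
\<close>

lemma tilted_exists:
  assumes F: "F \<in> distributions" and "\<gamma> > 0"
  shows "\<exists>!G. G \<in> distributions \<and> (\<forall>x<0. tail G x = 1) \<and>
           (\<forall>x\<ge>0. tail G x = tail F x * exp (- \<gamma> * x))"
proof -
  interpret real_distribution F using F by (simp add: distributions_iff)
  have rd: "real_distribution F" by unfold_locales
  have pos: "tail F x > 0" for x using F by (simp add: distributions_iff)
  have le1: "tail F x \<le> 1" for x by (simp add: tail_def cdf_def)
  define H where "H x = (if x < 0 then 0 else 1 - tail F x * exp (- \<gamma> * x))" for x
  have "H x \<le> H y" if "x \<le> y" for x y
  proof -
    have 1: "tail F x * exp (- \<gamma> * x) \<le> 1 * 1" if "x \<ge> 0" for x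
      using that \<open>\<gamma> > 0\<close> le1 by (intro mult_mono) auto
    have 2: "tail F y * exp (- \<gamma> * y) \<le> tail F x * exp (- \<gamma> * x)"
      using that \<open>\<gamma> > 0\<close> pos[of x]
      by (intro mult_mono) (auto simp: tail_def cdf_nondecreasing)
    show ?thesis using 1[of y] 2 that by (auto simp: H_def)
  qed note mono = this
  have rc: "continuous (at_right a) H" for a
  proof (cases "a < 0")
    case True
    have "eventually (\<lambda>x. x < 0) (at_right a)"
      using True by (intro eventually_at_rightI[of a 0]) auto
    then have "eventually (\<lambda>x. H x = 0) (at_right a)"
      by eventually_elim (simp add: H_def)
    then show ?thesis
      using True tendsto_eventually[of H 0] by (simp add: continuous_within H_def[of a])
  next
    case False
    have "((\<lambda>x. 1 - tail F x * exp (- \<gamma> * x)) \<longlongrightarrow> 1 - tail F a * exp (- \<gamma> * a)) (at_right a)"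
      using cdf_is_right_cont[of a] unfolding tail_def continuous_within
      by (intro tendsto_intros) auto
    moreover have "eventually (\<lambda>x. H x = 1 - tail F x * exp (- \<gamma> * x)) (at_right a)"
      using False eventually_at_right_less[of a] by (auto elim!: eventually_mono simp: H_def)
    ultimately show ?thesis
      using False by (simp add: continuous_within H_def[of a] tendsto_cong)
  qed
  have bot: "(H \<longlongrightarrow> 0) at_bot"
    by (intro tendsto_eventually) (auto simp: H_def eventually_at_bot_dense)
  have top: "(H \<longlongrightarrow> 1) at_top"
  proof -
    have "((\<lambda>x. 1 - (1 - cdf F x) * exp (- \<gamma> * x)) \<longlongrightarrow> 1 - (1 - 1) * 0) at_top"
      using \<open>\<gamma> > 0\<close> cdf_lim_at_top_prob
      by (intro tendsto_intros filterlim_compose[OF exp_at_bot]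
          filterlim_tendsto_neg_mult_at_bot[OF tendsto_const _ filterlim_ident]) auto
    moreover have "eventually (\<lambda>x. 1 - (1 - cdf F x) * exp (- \<gamma> * x) = H x) at_top"
      using eventually_ge_at_top[of 0] by eventually_elim (auto simp: H_def tail_def)
    ultimately show ?thesis using tendsto_cong by fastforce
  qed
  let ?G = "interval_measure H"
  have G: "real_distribution ?G" and cG: "cdf ?G = H"
    using real_distribution_interval_measure[OF mono rc bot top] cdf_interval_measure[OF mono rc bot]
    by auto
  interpret G: real_distribution ?G by fact
  have tG: "tail ?G x = (if x < 0 then 1 else tail F x * exp (- \<gamma> * x))" for x
    by (simp add: tail_def[of ?G] cG H_def)
  have "measure ?G {..<0} = 0"
  proof -
    have "(cdf ?G \<longlongrightarrow> measure ?G {..<0}) (at_left 0)" by (rule G.cdf_at_left)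
    moreover have "eventually (\<lambda>x. cdf ?G x = 0) (at_left 0)"
      unfolding cG using eventually_at_left_real[of "-1" "0::real"]
      by (auto elim!: eventually_mono simp: H_def)
    ultimately show ?thesis
      using tendsto_eventually tendsto_unique trivial_limit_at_left_real by metis
  qed
  then have "?G \<in> distributions"
    using G pos by (auto simp: distributions_iff tG)
  then show ?thesis
  proof (intro ex1I[of _ ?G], goal_cases)
    case 1 then show ?case by (simp add: tG)
  next
    case (2 G')
    then have "tail G' = tail ?G" by (auto simp: fun_eq_iff tG not_less)
    then have "cdf G' = cdf ?G" by (simp add: fun_eq_iff tail_def)
    then show ?case using 2 G by (auto intro: cdf_unique simp: distributions_iff)
  qed
qed

end

theory Submission imports Defs begin

text \<open>
  Write \<open>T\<close> for the tail of \<open>F\<close>, \<open>\<mu>\<close> for its mean, and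
  \<open>I(x) = \<integral>\<^sub>0\<^sup>x T(x - y) T(y) dy\<close>. Subexponential distributions are long-tailed, hence in \<open>\<K>\<close>, and
  the ranges near the two endpoints contribute \<open>2\<mu> T(x)\<close> to \<open>I(x)\<close>; so \<open>F \<notin> \<S>\<^sup>*\<close>
  means that \<open>I(x) > (2\<mu> + \<delta>) T(x)\<close> for some \<open>\<delta> > 0\<close> and arbitrarily large \<open>x\<close>.
  As \<open>G\<close> is the law of the minimum of an \<open>F\<close>-variable and an independent exponential variable of
  rate \<open>\<gamma>\<close>, one has \<open>G(dy) = e\<^bsup>-\<gamma>y\<^esup> (F(dy) + \<gamma> T(y) dy)\<close>. Hence the probability of \<open>S\<^sub>2 > x\<close> under \<open>G\<close> is
  \<open>e\<^bsup>-\<gamma>x\<^esup> (2 T(x) + o(T(x)) + \<gamma> I(x))\<close>, and for every \<open>K\<close> the part of it where both summands are at most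
  \<open>x - K\<close> is at least about \<open>e\<^bsup>-\<gamma>x\<^esup> (\<gamma> (I(x) - 2\<mu> T(x)) - T(K) T(x))\<close>. For large fixed \<open>K\<close> this is
  a fraction of the whole that stays bounded away from 0 along such \<open>x\<close>, uniformly in \<open>K\<close>.
\<close>

section \<open>Tails of distributions on the half-line, their integrals and the mean\<close>

lemma set_integral_mono_subset:
  fixes f :: "'a \<Rightarrow> real"
  assumes f: "set_integrable M B f" and "A \<in> sets M" "A \<subseteq> B"
    and nonneg: "\<And>x. x \<in> B \<Longrightarrow> 0 \<le> f x"
  shows "(LINT x:A|M. f x) \<le> (LINT x:B|M. f x)"
proof -
  have "set_integrable M A f" by (rule set_integrable_subset[OF assms(1-3)])
  with f show ?thesis
    unfolding set_lebesgue_integral_def set_integrable_def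
    using assms(3) nonneg by (intro integral_mono) (auto split: split_indicator)
qed

locale half_line_distribution = real_distribution F for F +
  assumes in_distributions: "F \<in> distributions"
begin

lemma tail_pos: "0 < tail F x"
  using in_distributions by (simp add: distributions_iff)

lemma tail_eq_prob: "tail F x = prob {x<..}"
  using tail_eq_measure real_distribution_axioms by blast

lemma emeasure_greaterThan: "emeasure F {x<..} = ennreal (tail F x)"
  by (simp add: tail_eq_prob emeasure_eq_measure)

lemma tail_le_1: "tail F x \<le> 1"
  by (simp add: tail_eq_prob)

lemma tail_antimono: "x \<le> y \<Longrightarrow> tail F y \<le> tail F x"
  by (simp add: tail_def cdf_nondecreasing)

lemma AE_nonneg: "AE x in F. 0 \<le> x"
  using in_distributions
  by (intro AE_I[of _ _ "{..<0}"]) (auto simp: distributions_iff emeasure_eq_measure)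

lemma tail_neg: "x < 0 \<Longrightarrow> tail F x = 1"
  unfolding tail_eq_prob by (intro prob_eq_1[THEN iffD2]) (use AE_nonneg in auto)

lemma borel_measurable_tail [measurable]: "tail F \<in> borel_measurable borel"
proof -
  have "mono (\<lambda>x. - tail F x)"
    by (auto simp: mono_def tail_antimono)
  then have "(\<lambda>x. - (- tail F x)) \<in> borel_measurable borel"
    by (intro borel_measurable_uminus borel_measurable_mono)
  then show ?thesis by simp
qed

lemma set_integrable_tail:
  assumes "A \<in> sets borel" "bounded A"
  shows "set_integrable lborel A (\<lambda>y. tail F (x - y) * tail F y)"
    "set_integrable lborel A (tail F)"
proof -
  have A: "emeasure lborel A < \<infinity>" using assms(2) by (rule emeasure_bounded_finite)
  have 1: "tail F u * tail F v \<le> 1" for u v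
    using mult_mono[OF tail_le_1[of u] tail_le_1[of v]] tail_pos[of v] by simp
  have 2: "0 \<le> tail F u * tail F v" "0 \<le> tail F u" for u v using tail_pos[of u] tail_pos[of v] by simp_all
  show "set_integrable lborel A (\<lambda>y. tail F (x - y) * tail F y)"
    unfolding set_integrable_def
    using A assms(1) by (intro Bochner_Integration.integrable_bound[OF integrable_real_indicator[of A lborel]] AE_I2)
      (auto simp: indicator_def 1 2)
  show "set_integrable lborel A (tail F)"
    unfolding set_integrable_def
    using A assms(1) by (intro Bochner_Integration.integrable_bound[OF integrable_real_indicator[of A lborel]] AE_I2)
      (auto simp: indicator_def 2 tail_le_1)
qed

text \<open>Tonelli, with \<open>tail F y\<close> read as the \<open>F\<close>-mass of
  \<open>{y<..}\<close>. Taking \<open>h = 1\<close> yields the mean; taking for \<open>h\<close> an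
  integrand times an exponential density yields the Lebesgue part of the law of the tilt.\<close>

lemma nn_integral_tail:
  assumes [measurable]: "h \<in> borel_measurable borel"
  shows "(\<integral>\<^sup>+y. h y * indicator {0..} y * ennreal (tail F y) \<partial>lborel)
    = (\<integral>\<^sup>+u. (\<integral>\<^sup>+y. h y * indicator {0..<u} y \<partial>lborel) \<partial>F)"
proof -
  interpret P: pair_sigma_finite lborel F ..
  have "(\<integral>\<^sup>+y. h y * indicator {0..} y * ennreal (tail F y) \<partial>lborel)
    = (\<integral>\<^sup>+y. (\<integral>\<^sup>+u. h y * indicator {0..} y * indicator {y<..} u \<partial>F) \<partial>lborel)"
    by (intro nn_integral_cong) (simp add: nn_integral_cmult emeasure_greaterThan)
  also have "\<dots> = (\<integral>\<^sup>+u. (\<integral>\<^sup>+y. h y * indicator {0..} y * indicator {y<..} u \<partial>lborel) \<partial>F)"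
    by (rule P.Fubini'[symmetric]) (simp add: greaterThan_def)
  also have "\<dots> = (\<integral>\<^sup>+u. (\<integral>\<^sup>+y. h y * indicator {0..<u} y \<partial>lborel) \<partial>F)"
    by (intro nn_integral_cong) (auto split: split_indicator)
  finally show ?thesis .
qed

lemma nn_integral_tail_eq_mean:
  "(\<integral>\<^sup>+y. indicator {0..} y * ennreal (tail F y) \<partial>lborel) = (\<integral>\<^sup>+u. ennreal u \<partial>F)"
proof -
  have "(\<integral>\<^sup>+u. (\<integral>\<^sup>+y. 1 * indicator {0..<u} y \<partial>lborel) \<partial>F) = (\<integral>\<^sup>+u. ennreal u \<partial>F)"
    using AE_nonneg by (intro nn_integral_cong_AE) auto
  then show ?thesis using nn_integral_tail[of "\<lambda>_. 1"] by simp
qed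

lemma
  assumes "finite_mean F"
  shows set_integrable_tail_atLeast: "set_integrable lborel {0..} (tail F)"
    and set_integral_tail_eq_mean: "(LBINT y:{0..}. tail F y) = mean F"
proof -
  have "(\<integral>\<^sup>+u. ennreal u \<partial>F) = ennreal (mean F)"
    using assms AE_nonneg by (simp add: nn_integral_eq_integral finite_mean_def mean_def)
  then have *: "(\<integral>\<^sup>+y. ennreal (indicator {0..} y * tail F y) \<partial>lborel) = ennreal (mean F)"
    using nn_integral_tail_eq_mean by (simp add: ennreal_mult'' less_imp_le[OF tail_pos] ennreal_indicator)
  have "0 \<le> mean F" using AE_nonneg by (simp add: mean_def integral_nonneg_AE)
  with * show "set_integrable lborel {0..} (tail F)" "(LBINT y:{0..}. tail F y) = mean F"
    unfolding set_integrable_def set_lebesgue_integral_def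
    using nn_integral_eq_integrable[of "\<lambda>y. indicator {0..} y * tail F y" lborel "mean F"] tail_pos
    by (auto simp: less_imp_le)
qed

lemma set_integral_tail_le_mean:
  assumes "finite_mean F"
  shows "(LBINT y:{0..a}. tail F y) \<le> mean F"
  unfolding set_integral_tail_eq_mean[OF assms, symmetric]
  using set_integrable_tail_atLeast[OF assms] tail_pos
  by (intro set_integral_mono_subset) (auto simp: less_imp_le)

text \<open>The tail is positive and decreasing, so \<open>{0..1}\<close> alone contributes at least
  \<open>tail F 1\<close>. Positivity is one of the clauses of \<open>class_S_star\<close>, so it
  has to be excluded as the reason for non-membership.\<close>

lemma mean_pos:
  assumes "finite_mean F"
  shows "0 < mean F"
proof -
  have "tail F 1 = (LBINT y:{0..1::real}. tail F 1)" by (subst set_integral_const) auto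
  also have "\<dots> \<le> (LBINT y:{0..1}. tail F y)"
    using tail_antimono by (intro set_integral_mono set_integrable_tail) (auto simp: set_integrable_def)
  also have "\<dots> \<le> mean F" by (rule set_integral_tail_le_mean[OF assms])
  finally show ?thesis using tail_pos[of 1] by simp
qed

lemma set_integral_tail_tendsto_mean:
  assumes "finite_mean F"
  shows "((\<lambda>a. LBINT y:{0..a}. tail F y) \<longlongrightarrow> mean F) at_top"
  unfolding set_integral_tail_eq_mean[OF assms, symmetric]
  by (rule tendsto_set_lebesgue_integral_at_top[OF _ set_integrable_tail_atLeast[OF assms]]) auto

section \<open>Two-fold convolutions and events of two independent coordinates\<close>

lemma tail_eq_integral_conv:
  "tail (F \<star> F) x = (\<integral>y. tail F (x - y) \<partial>F)"
proof -
  interpret P: pair_prob_space F F ..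
  interpret C: real_distribution "F \<star> F"
    unfolding convolution_def by (rule P.real_distribution_distr) simp
  have "ennreal (tail (F \<star> F) x) = emeasure (F \<star> F) {x<..}"
    by (simp add: tail_eq_measure C.real_distribution_axioms C.emeasure_eq_measure)
  also have "\<dots> = (\<integral>\<^sup>+y. emeasure F {a. a + y \<in> {x<..}} \<partial>F)"
    by (rule convolution_emeasure) (simp_all add: finite_measure_axioms)
  also have "\<dots> = (\<integral>\<^sup>+y. ennreal (tail F (x - y)) \<partial>F)"
    by (intro nn_integral_cong) (simp add: emeasure_greaterThan[symmetric] greaterThan_def less_diff_eq diff_less_eq)
  also have "\<dots> = ennreal (\<integral>y. tail F (x - y) \<partial>F)"
    using tail_pos tail_le_1
    by (intro nn_integral_eq_integral integrable_const_bound[of _ 1]) (auto simp: less_imp_le)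
  finally show ?thesis
    using tail_pos by (subst (asm) ennreal_inj) (auto simp: less_imp_le tail_eq_measure C.real_distribution_axioms intro!: integral_nonneg)
qed

lemma set_integrable_tail_dist:
  "A \<in> sets borel \<Longrightarrow> set_integrable F A (\<lambda>y. tail F (x - y))"
  unfolding set_integrable_def
  using tail_pos tail_le_1
  by (intro integrable_const_bound[of _ 1]) (auto simp: less_imp_le split: split_indicator)

text \<open>Conditioning on one summand \<open>y\<close>: if \<open>y > x\<close>, the sum exceeds
  \<open>x\<close> almost surely, which is the separate term \<open>tail F x\<close>; negative
  \<open>y\<close> form a null set.\<close>

lemma tail_convolution:
  assumes "0 \<le> x"
  shows "tail (F \<star> F) x = tail F x + (LINT y:{0..x}|F. tail F (x - y))"
proof -
  have "(\<integral>y. tail F (x - y) \<partial>F) = (LINT y:{0..x} \<union> {x<..}|F. tail F (x - y))"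
    unfolding set_lebesgue_integral_def
    using AE_nonneg by (intro integral_cong_AE) (auto split: split_indicator)
  also have "\<dots> = (LINT y:{0..x}|F. tail F (x - y)) + (LINT y:{x<..}|F. tail F (x - y))"
    by (intro set_integral_Un set_integrable_tail_dist) auto
  also have "(LINT y:{x<..}|F. tail F (x - y)) = (LINT y:{x<..}|F. 1)"
    by (intro set_lebesgue_integral_cong) (auto simp: tail_neg)
  also have "\<dots> = tail F x"
    by (simp add: set_lebesgue_integral_def tail_eq_prob)
  finally show ?thesis by (simp add: tail_eq_integral_conv)
qed

text \<open>Links the product space of \<open>class_J\<close> at n = 2 to one-dimensional integrals:
  the law of the two coordinates is the binary product, and its measure is computed by
  sections.\<close>

lemma prob_pair_eq:
  assumes [measurable]: "Measurable.pred (borel \<Otimes>\<^sub>M borel) (\<lambda>p. P (fst p) (snd p))"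
  shows "measure (\<Pi>\<^sub>M i\<in>{1..2::nat}. F) {X \<in> space (\<Pi>\<^sub>M i\<in>{1..2::nat}. F). P (X 1) (X 2)}
    = (\<integral>y. prob {z. P y z} \<partial>F)"
proof -
  interpret PS: product_sigma_finite "\<lambda>_::nat. F" ..
  have [measurable]: "Measurable.pred (F \<Otimes>\<^sub>M F) (\<lambda>p. P (fst p) (snd p))"
    using assms by (simp cong: measurable_cong_sets)
  have S [measurable]: "{p. P (fst p) (snd p)} \<in> sets (F \<Otimes>\<^sub>M F)"
  proof -
    have "{p \<in> space (F \<Otimes>\<^sub>M F). P (fst p) (snd p)} \<in> sets (F \<Otimes>\<^sub>M F)" by measurable
    then show ?thesis by (simp add: space_pair_measure)
  qed
  have eq: "{1..2} = {1, 2::nat}" by auto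
  have [measurable]: "Measurable.pred (\<Pi>\<^sub>M i\<in>{1..2::nat}. F) (\<lambda>X. P (X 1) (X 2))"
  proof -
    have "(\<lambda>X. (X 1, X 2)) \<in> (\<Pi>\<^sub>M i\<in>{1..2::nat}. F) \<rightarrow>\<^sub>M F \<Otimes>\<^sub>M F" by measurable
    from measurable_compose[OF this, of "\<lambda>p. P (fst p) (snd p)"] show ?thesis by simp
  qed
  have "emeasure (\<Pi>\<^sub>M i\<in>{1..2::nat}. F) {X \<in> space (\<Pi>\<^sub>M i\<in>{1..2::nat}. F). P (X 1) (X 2)}
    = (\<integral>\<^sup>+X. indicator {p. P (fst p) (snd p)} (X 1, X 2) \<partial>(\<Pi>\<^sub>M i\<in>{1..2::nat}. F))"
    by (subst nn_integral_indicator[of "{X \<in> space (\<Pi>\<^sub>M i\<in>{1..2::nat}. F). P (X 1) (X 2)}", symmetric], measurable)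
      (auto intro!: nn_integral_cong split: split_indicator)
  also have "\<dots> = (\<integral>\<^sup>+z. indicator {p. P (fst p) (snd p)} (fst z, snd z) \<partial>(F \<Otimes>\<^sub>M F))"
    unfolding eq by (rule PS.product_nn_integral_pair) auto
  also have "\<dots> = emeasure (F \<Otimes>\<^sub>M F) {p. P (fst p) (snd p)}"
    unfolding prod.collapse by (rule nn_integral_indicator[OF S])
  also have "\<dots> = (\<integral>\<^sup>+y. prob {z. P y z} \<partial>F)"
    using emeasure_pair_measure_alt[OF S] by (simp add: emeasure_eq_measure vimage_def)
  also have "\<dots> = ennreal (\<integral>y. prob {z. P y z} \<partial>F)"
  proof (intro nn_integral_eq_integral integrable_const_bound[of _ 1])
    show "(\<lambda>y. prob {z. P y z}) \<in> borel_measurable F"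
      using measurable_emeasure_Pair[of "{p. P (fst p) (snd p)}" F] by (simp add: measure_def)
  qed auto
  finally show ?thesis
    by (intro measure_eq_emeasure_eq_ennreal integral_nonneg) auto
qed

end

section \<open>The tilted distribution as the law of a minimum\<close>

locale exponential_tilt = F: half_line_distribution F + G: half_line_distribution G
  for F G +
  fixes \<gamma> :: real
  assumes rate_pos: "\<gamma> > 0"
    and tail_tilt: "\<And>x. 0 \<le> x \<Longrightarrow> tail G x = tail F x * exp (- \<gamma> * x)"
begin

abbreviation "expo \<equiv> density lborel (exponential_density \<gamma>)"

text \<open>The minimum exceeds \<open>x\<close> iff both independent components do, so its tail is
  the product of their tails. The exponential component is almost surely positive, hence the
  \<open>max 0 x\<close> in its tail; equality of the distribution functions then identifies the
  laws.\<close>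

lemma tilt_eq_distr_min: "G = distr (F \<Otimes>\<^sub>M expo) borel (\<lambda>(u, t). min u t)"
proof -
  interpret E: prob_space expo
    by (rule prob_space_exponential_density[OF rate_pos])
  interpret P: pair_prob_space F expo ..
  let ?D = "distr (F \<Otimes>\<^sub>M expo) borel (\<lambda>(u, t). min u t)"
  have rd: "real_distribution ?D" by (rule P.real_distribution_distr) simp
  then interpret D: real_distribution ?D .
  have expo: "emeasure expo {x<..} = ennreal (exp (- \<gamma> * max 0 x))" for x
  proof -
    have "distributed expo lborel (\<lambda>x. x) (exponential_density \<gamma>)"
      by (auto simp: distributed_def distr_id2)
    from E.exponential_distributedD_gt[OF this _ rate_pos, of "max 0 x"]
    have "E.prob {max 0 x<..} = exp (- \<gamma> * max 0 x)"
      by (simp add: greaterThan_def mult.commute)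
    moreover have "E.prob {x<..} = E.prob {max 0 x<..}"
    proof -
      have "AE t in expo. 0 < t"
      proof (subst AE_density)
        have "AE t in lborel. t \<noteq> (0::real)" by (rule AE_lborel_singleton)
        then show "AE t in lborel. 0 < ennreal (exponential_density \<gamma> t) \<longrightarrow> 0 < t"
          by eventually_elim (auto simp: exponential_density_def)
      qed simp
      then show ?thesis by (intro E.finite_measure_eq_AE) auto
    qed
    ultimately show ?thesis by (simp add: E.emeasure_eq_measure)
  qed
  have "tail ?D x = tail G x" for x
  proof -
    have "ennreal (tail ?D x) = emeasure ?D {x<..}"
      by (simp add: tail_eq_measure rd D.emeasure_eq_measure)
    also have "\<dots> = emeasure (F \<Otimes>\<^sub>M expo) ({x<..} \<times> {x<..})"
      by (subst emeasure_distr) (auto intro!: arg_cong[where f="emeasure _"] simp: space_pair_measure)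
    also have "\<dots> = ennreal (tail F x * exp (- \<gamma> * max 0 x))"
      using F.tail_pos[of x]
      by (subst E.emeasure_pair_measure_Times) (auto simp: expo F.emeasure_greaterThan ennreal_mult)
    also have "tail F x * exp (- \<gamma> * max 0 x) = tail G x"
      by (cases "x < 0") (auto simp: F.tail_neg G.tail_neg tail_tilt)
    finally show ?thesis
      using G.tail_pos[of x] by (subst (asm) ennreal_inj) (auto simp: tail_eq_measure rd)
  qed
  then have "cdf G = cdf ?D" by (simp add: fun_eq_iff tail_def)
  then show ?thesis using rd by (intro cdf_unique) unfold_locales
qed

text \<open>Fix the \<open>F\<close>-component \<open>u\<close>. The exponential time is at least
  \<open>u\<close> with probability \<open>exp (- \<gamma> * u)\<close>, and the minimum is then
  \<open>u\<close>; otherwise it is that time, with its density on \<open>{0..<u}\<close>.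
  Integrating over \<open>u\<close> and applying \<open>nn_integral_tail\<close> turns the second
  contribution into a Lebesgue integral weighted by the tail.\<close>

lemma nn_integral_tilt:
  assumes [measurable]: "g \<in> borel_measurable borel"
  shows "(\<integral>\<^sup>+y. g y \<partial>G) = (\<integral>\<^sup>+y. g y * ennreal (exp (- \<gamma> * y)) \<partial>F)
    + (\<integral>\<^sup>+y. g y * ennreal (\<gamma> * exp (- \<gamma> * y)) * indicator {0..} y * ennreal (tail F y) \<partial>lborel)"
proof -
  interpret E: prob_space expo
    by (rule prob_space_exponential_density[OF rate_pos])
  interpret P: pair_prob_space F expo ..
  have "(\<integral>\<^sup>+y. g y \<partial>G) = (\<integral>\<^sup>+p. g (min (fst p) (snd p)) \<partial>(F \<Otimes>\<^sub>M expo))"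
    by (subst tilt_eq_distr_min, subst nn_integral_distr) (auto simp: case_prod_beta)
  also have "\<dots> = (\<integral>\<^sup>+u. (\<integral>\<^sup>+t. g (min u t) \<partial>expo) \<partial>F)"
    by (subst E.nn_integral_fst[symmetric]) auto
  also have "\<dots> = (\<integral>\<^sup>+u. g u * ennreal (exp (- \<gamma> * u))
      + (\<integral>\<^sup>+y. g y * ennreal (\<gamma> * exp (- \<gamma> * y)) * indicator {0..<u} y \<partial>lborel) \<partial>F)"
  proof (rule nn_integral_cong_AE)
    show "AE u in F. (\<integral>\<^sup>+t. g (min u t) \<partial>expo) = g u * ennreal (exp (- \<gamma> * u))
      + (\<integral>\<^sup>+y. g y * ennreal (\<gamma> * exp (- \<gamma> * y)) * indicator {0..<u} y \<partial>lborel)"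
      using F.AE_nonneg
    proof eventually_elim
      case (elim u)
      have "((\<lambda>t. - exp (- \<gamma> * t)) \<longlongrightarrow> - 0) at_top"
        using rate_pos by (intro tendsto_intros filterlim_compose[OF exp_at_bot]
          filterlim_tendsto_neg_mult_at_bot[OF tendsto_const _ filterlim_ident]) auto
      then have T: "(\<integral>\<^sup>+t. ennreal (\<gamma> * exp (- \<gamma> * t)) * indicator {u..} t \<partial>lborel) = ennreal (exp (- \<gamma> * u))"
        using rate_pos
        by (subst nn_integral_FTC_atLeast[where F="\<lambda>t. - exp (- \<gamma> * t)" and T="- 0"])
          (auto intro!: derivative_eq_intros)
      have "(\<integral>\<^sup>+t. g (min u t) \<partial>expo)
        = (\<integral>\<^sup>+t. g u * (ennreal (\<gamma> * exp (- \<gamma> * t)) * indicator {u..} t)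
          + g t * ennreal (\<gamma> * exp (- \<gamma> * t)) * indicator {0..<u} t \<partial>lborel)"
        using elim
        by (subst nn_integral_density)
          (auto intro!: nn_integral_cong simp: exponential_density_def ac_simps split: split_indicator)
      then show ?case
        by (subst (asm) nn_integral_add) (auto simp: nn_integral_cmult T[simplified])
    qed
  qed
  also have "\<dots> = (\<integral>\<^sup>+u. g u * ennreal (exp (- \<gamma> * u)) \<partial>F)
      + (\<integral>\<^sup>+u. (\<integral>\<^sup>+y. g y * ennreal (\<gamma> * exp (- \<gamma> * y)) * indicator {0..<u} y \<partial>lborel) \<partial>F)"
  proof (rule nn_integral_add)
    \<comment> \<open>Measurability in \<open>u\<close> becomes visible once the indicator of
      \<open>{0..<u}\<close> is factored into indicators of conditions on \<open>y\<close> and on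
      the pair.\<close>
    have "(\<lambda>u. \<integral>\<^sup>+y. g y * ennreal (\<gamma> * exp (- \<gamma> * y)) * (indicator {0..} y * indicator {y<..} u) \<partial>lborel) \<in> borel_measurable F"
      by (simp add: greaterThan_def)
    also have "(\<lambda>u. \<integral>\<^sup>+y. g y * ennreal (\<gamma> * exp (- \<gamma> * y)) * (indicator {0..} y * indicator {y<..} u) \<partial>lborel)
      = (\<lambda>u. \<integral>\<^sup>+y. g y * ennreal (\<gamma> * exp (- \<gamma> * y)) * indicator {0..<u} y \<partial>lborel)"
      by (intro ext nn_integral_cong) (auto split: split_indicator)
    finally show "(\<lambda>u. \<integral>\<^sup>+y. g y * ennreal (\<gamma> * exp (- \<gamma> * y)) * indicator {0..<u} y \<partial>lborel) \<in> borel_measurable F" .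
  qed auto
  finally show ?thesis by (subst F.nn_integral_tail) auto
qed

text \<open>The exponents add up: \<open>exp (- \<gamma> * (x - y))\<close> from the tail and
  \<open>exp (- \<gamma> * y)\<close> from the law give \<open>exp (- \<gamma> * x)\<close> for
  every \<open>y\<close>. For \<open>y\<close> in \<open>A\<close> both \<open>y\<close> and
  \<open>x - y\<close> are nonnegative, where the tilt formula applies.\<close>

lemma set_integral_tilt:
  assumes A: "A \<in> sets borel" "A \<subseteq> {0..x}"
  shows "(LINT y:A|G. tail G (x - y)) = exp (- \<gamma> * x) *
    ((LINT y:A|F. tail F (x - y)) + \<gamma> * (LBINT y:A. tail F (x - y) * tail F y))"
proof -
  note [measurable] = A(1)
  have bdd: "bounded A" using A(2) bounded_subset bounded_closed_interval by blast
  have pos: "0 \<le> tail F u" "0 \<le> tail G u" for u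
    using F.tail_pos[of u] G.tail_pos[of u] by auto
  have ind: "indicator A y * (tail G (x - y) * exp (- \<gamma> * y)) = exp (- \<gamma> * x) * (indicator A y * tail F (x - y))" for y
    using A(2) by (auto simp: tail_tilt exp_add[symmetric] algebra_simps split: split_indicator)
  have i1: "integrable G (\<lambda>y. indicator A y * tail G (x - y))"
    using G.set_integrable_tail_dist[OF A(1), of x] by (simp add: set_integrable_def)
  have i2: "integrable F (\<lambda>y. indicator A y * tail F (x - y))"
    using F.set_integrable_tail_dist[OF A(1), of x] by (simp add: set_integrable_def)
  have i3: "integrable lborel (\<lambda>y. indicator A y * (tail F (x - y) * tail F y))"
    using F.set_integrable_tail(1)[OF A(1) bdd, of x] by (simp add: set_integrable_def)
  let ?c = "exp (- \<gamma> * x)"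
  have "ennreal (LINT y:A|G. tail G (x - y)) = (\<integral>\<^sup>+y. ennreal (indicator A y * tail G (x - y)) \<partial>G)"
    using i1 pos by (simp add: set_lebesgue_integral_def nn_integral_eq_integral)
  also have "\<dots> = (\<integral>\<^sup>+y. ennreal (?c * (indicator A y * tail F (x - y))) \<partial>F)
    + (\<integral>\<^sup>+y. ennreal (?c * \<gamma> * (indicator A y * (tail F (x - y) * tail F y))) \<partial>lborel)"
  proof (subst nn_integral_tilt, simp, intro arg_cong2[where f="(+)"] nn_integral_cong)
    fix y
    show "ennreal (indicator A y * tail G (x - y)) * ennreal (exp (- \<gamma> * y)) = ennreal (?c * (indicator A y * tail F (x - y)))"
      unfolding ind[symmetric] using pos by (simp add: ennreal_mult[symmetric] ac_simps)
    show "ennreal (indicator A y * tail G (x - y)) * ennreal (\<gamma> * exp (- \<gamma> * y)) * indicator {0..} y * ennreal (tail F y)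
      = ennreal (?c * \<gamma> * (indicator A y * (tail F (x - y) * tail F y)))"
    proof (cases "y \<in> A")
      case True
      then have "tail G (x - y) * exp (- \<gamma> * y) = ?c * tail F (x - y)" using ind[of y] by simp
      then have "tail G (x - y) * (\<gamma> * exp (- \<gamma> * y)) * tail F y = ?c * \<gamma> * (tail F (x - y) * tail F y)"
        by (simp add: ac_simps)
      then show ?thesis
        using True A(2) pos rate_pos by (auto simp: ennreal_mult[symmetric])
    qed simp
  qed
  also have "\<dots> = ennreal (?c * (LINT y:A|F. tail F (x - y))) + ennreal (?c * \<gamma> * (LBINT y:A. tail F (x - y) * tail F y))"
    using i2 i3 pos rate_pos by (simp add: set_lebesgue_integral_def nn_integral_eq_integral del: mult_minus_left)
  also have "\<dots> = ennreal (?c * ((LINT y:A|F. tail F (x - y)) + \<gamma> * (LBINT y:A. tail F (x - y) * tail F y)))"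
    using pos rate_pos
    by (subst ennreal_plus[symmetric])
      (auto simp: set_lebesgue_integral_def algebra_simps intro!: mult_nonneg_nonneg integral_nonneg)
  finally show ?thesis
    using pos rate_pos by (subst (asm) ennreal_inj)
      (auto simp: set_lebesgue_integral_def intro!: mult_nonneg_nonneg add_nonneg_nonneg integral_nonneg)
qed

end

section \<open>The integral of the product of two tails\<close>

context half_line_distribution begin

text \<open>The reflection of \<open>y\<close> to \<open>x - y\<close> preserves the integrand and
  exchanges the two end ranges, up to a single point.\<close>

lemma set_integral_tail_product_split:
  assumes "0 \<le> a" "2 * a \<le> x"
  shows "(LBINT y:{0..x}. tail F (x - y) * tail F y)
    = 2 * (LBINT y:{0..a}. tail F (x - y) * tail F y)
      + (LBINT y:{a<..x - a}. tail F (x - y) * tail F y)"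
proof -
  let ?f = "\<lambda>y. tail F (x - y) * tail F y"
  note int = set_integrable_tail(1)
  have "(LBINT y:{x - a<..x}. ?f y) = (LBINT y. indicator {x - a<..x} (x + -1 * y) *\<^sub>R ?f (x + -1 * y))"
    unfolding set_lebesgue_integral_def by (subst lborel_integral_real_affine[where c="-1" and t=x]) simp_all
  also have "\<dots> = (LBINT y:{0..<a}. ?f y)"
    unfolding set_lebesgue_integral_def
    by (intro Bochner_Integration.integral_cong) (auto simp: mult.commute split: split_indicator)
  also have "\<dots> = (LBINT y:{0..a}. ?f y)"
    unfolding set_lebesgue_integral_def using AE_lborel_singleton[of a]
    by (intro integral_cong_AE) (auto elim!: eventually_mono split: split_indicator)
  finally have refl: "(LBINT y:{x - a<..x}. ?f y) = (LBINT y:{0..a}. ?f y)" .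
  have "{0..x} = ({0..a} \<union> {a<..x - a}) \<union> {x - a<..x}"
    using assms by auto
  then have "(LBINT y:{0..x}. ?f y) = (LBINT y:({0..a} \<union> {a<..x - a}) \<union> {x - a<..x}. ?f y)"
    by (rule arg_cong)
  also have "\<dots> = (LBINT y:{0..a} \<union> {a<..x - a}. ?f y) + (LBINT y:{x - a<..x}. ?f y)"
    using assms by (intro set_integral_Un int) auto
  also have "(LBINT y:{0..a} \<union> {a<..x - a}. ?f y) = (LBINT y:{0..a}. ?f y) + (LBINT y:{a<..x - a}. ?f y)"
    by (intro set_integral_Un int) auto
  finally show ?thesis using refl by simp
qed

lemma set_integral_tail_product_nonneg: "0 \<le> (LBINT y:A. tail F (x - y) * tail F y)"
  using tail_pos by (auto simp: set_lebesgue_integral_def less_imp_le intro!: integral_nonneg mult_nonneg_nonneg)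

text \<open>On each end range one factor is at most \<open>tail F (x - a)\<close> and the other
  integrates to at most the mean. Read backwards, this bounds the middle range from below.\<close>

lemma set_integral_tail_product_le:
  assumes "finite_mean F" "0 \<le> a" "2 * a \<le> x"
  shows "(LBINT y:{0..x}. tail F (x - y) * tail F y)
    \<le> 2 * mean F * tail F (x - a) + (LBINT y:{a<..x - a}. tail F (x - y) * tail F y)"
proof -
  have "(LBINT y:{0..a}. tail F (x - y) * tail F y) \<le> (LBINT y:{0..a}. tail F (x - a) * tail F y)"
    using tail_antimono tail_pos
    by (intro set_integral_mono set_integrable_mult_right set_integrable_tail) (auto intro!: mult_right_mono less_imp_le)
  also have "\<dots> \<le> tail F (x - a) * mean F"
    using set_integral_tail_le_mean[OF assms(1)] tail_pos[of "x - a"] by simp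
  finally show ?thesis
    by (simp add: set_integral_tail_product_split[OF assms(2,3)] mult.commute[of "mean F"])
qed

text \<open>Splitting at the midpoint, with the first factor bounded below by
  \<open>tail F x\<close> on each half. This makes \<open>2 * mean F\<close> a lower bound for the
  upper limit in \<open>class_S_star\<close>.\<close>

lemma set_integral_tail_product_ge:
  assumes "0 \<le> x"
  shows "2 * tail F x * (LBINT y:{0..x / 2}. tail F y) \<le> (LBINT y:{0..x}. tail F (x - y) * tail F y)"
proof -
  have "tail F x * (LBINT y:{0..x / 2}. tail F y) = (LBINT y:{0..x / 2}. tail F x * tail F y)" by simp
  also have "\<dots> \<le> (LBINT y:{0..x / 2}. tail F (x - y) * tail F y)"
    using tail_antimono tail_pos
    by (intro set_integral_mono set_integrable_mult_right set_integrable_tail) (auto intro!: mult_right_mono less_imp_le)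
  finally show ?thesis
    using set_integral_tail_product_split[of "x / 2" x] assms set_integral_tail_product_nonneg[of "{x/2<..x - x/2}" x]
    by simp
qed

section \<open>Consequences of subexponentiality and of failing to be strongly
  subexponential\<close>

lemma tail_tendsto_0: "(tail F \<longlongrightarrow> 0) at_top"
  unfolding tail_def using tendsto_diff[OF tendsto_const cdf_lim_at_top_prob, of 1] by simp

lemma subexponential_convolution_tendsto:
  assumes "F \<in> class_S"
  shows "((\<lambda>x. (LINT y:{0..x}|F. tail F (x - y)) / tail F x) \<longlongrightarrow> 1) at_top"
proof -
  have nz: "tail F x \<noteq> 0" for x using tail_pos[of x] by simp
  have "((\<lambda>x. tail (F \<star> F) x / (2 * tail F x)) \<longlongrightarrow> 1) at_top"
    using assms nz by (simp add: class_S_def asymp_equiv_def)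
  then have "((\<lambda>x. 2 * (tail (F \<star> F) x / (2 * tail F x)) - 1) \<longlongrightarrow> 2 * 1 - 1) at_top"
    by (intro tendsto_intros)
  moreover have "eventually (\<lambda>x. 2 * (tail (F \<star> F) x / (2 * tail F x)) - 1
      = (LINT y:{0..x}|F. tail F (x - y)) / tail F x) at_top"
    using eventually_ge_at_top[of 0]
    by eventually_elim (simp add: tail_convolution nz add_divide_distrib)
  ultimately show ?thesis by (simp add: tendsto_cong)
qed

text \<open>Split the convolution integral at \<open>a\<close>: the integrand is at least
  \<open>tail F x\<close> on \<open>{0..a}\<close> and at least \<open>tail F (x - a)\<close> on
  \<open>{a<..x}\<close>. The whole is asymptotically \<open>tail F x\<close>, so solving for the
  ratio leaves an upper bound with limit \<open>(1 - (1 - tail F a)) / tail F a\<close>, which is 1;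
  monotonicity supplies the lower bound 1.\<close>

lemma subexponential_long_tailed:
  assumes "F \<in> class_S" "0 \<le> a"
  shows "((\<lambda>x. tail F (x - a) / tail F x) \<longlongrightarrow> 1) at_top"
proof -
  let ?c = "\<lambda>x. (LINT y:{0..x}|F. tail F (x - y))"
  have nz: "tail F x \<noteq> 0" for x using tail_pos[of x] by simp
  have lo: "tail F x * (1 - tail F a) + tail F (x - a) * (tail F a - tail F x) \<le> ?c x" if "a \<le> x" for x
  proof -
    have "prob {0..a} = prob {..a}"
      using AE_nonneg by (intro finite_measure_eq_AE) auto
    then have 1: "prob {0..a} = 1 - tail F a" by (simp add: tail_def cdf_def)
    have "{a<..} = {a<..x} \<union> {x<..}" using that by auto
    then have "tail F a = prob ({a<..x} \<union> {x<..})" by (simp add: tail_eq_prob)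
    also have "\<dots> = prob {a<..x} + prob {x<..}" by (intro finite_measure_Union) auto
    finally have 2: "prob {a<..x} = tail F a - tail F x" by (simp add: tail_eq_prob)
    have "tail F x * prob {0..a} + tail F (x - a) * prob {a<..x}
      = (LINT y:{0..a}|F. tail F x) + (LINT y:{a<..x}|F. tail F (x - a))"
      by (subst (1 2) set_integral_const) (auto simp: mult.commute emeasure_eq_measure)
    also have "\<dots> \<le> (LINT y:{0..a}|F. tail F (x - y)) + (LINT y:{a<..x}|F. tail F (x - y))"
      using tail_antimono
      by (intro add_mono set_integral_mono set_integrable_tail_dist)
        (auto simp: set_integrable_def emeasure_eq_measure)
    also have "\<dots> = (LINT y:{0..a} \<union> {a<..x}|F. tail F (x - y))"
      by (intro set_integral_Un[symmetric] set_integrable_tail_dist) auto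
    also have "{0..a} \<union> {a<..x} = {0..x}" using that assms(2) by auto
    finally show ?thesis by (simp add: 1 2)
  qed
  show ?thesis
  proof (rule tendsto_sandwich)
    show "\<forall>\<^sub>F x in at_top. 1 \<le> tail F (x - a) / tail F x"
      using tail_antimono[of "x - a" x for x] tail_pos assms(2) by (intro always_eventually) simp
    have "\<forall>\<^sub>F x in at_top. tail F x < tail F a"
      using tail_tendsto_0 tail_pos by (rule order_tendstoD)
    then show "\<forall>\<^sub>F x in at_top. tail F (x - a) / tail F x \<le> (?c x / tail F x - (1 - tail F a)) / (tail F a - tail F x)"
      using eventually_ge_at_top[of a]
    proof eventually_elim
      case (elim x)
      have "tail F (x - a) / tail F x * (tail F a - tail F x)
        = (tail F x * (1 - tail F a) + tail F (x - a) * (tail F a - tail F x)) / tail F x - (1 - tail F a)"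
        using nz[of x] by (simp add: field_simps)
      also have "\<dots> \<le> ?c x / tail F x - (1 - tail F a)"
        using lo[of x] elim tail_pos[of x] by (simp add: divide_right_mono)
      finally show ?case using elim by (simp add: pos_le_divide_eq)
    qed
    have "((\<lambda>x. (?c x / tail F x - (1 - tail F a)) / (tail F a - tail F x)) \<longlongrightarrow> (1 - (1 - tail F a)) / (tail F a - 0)) at_top"
      using nz by (intro tendsto_intros subexponential_convolution_tendsto assms tail_tendsto_0) auto
    then show "((\<lambda>x. (?c x / tail F x - (1 - tail F a)) / (tail F a - tail F x)) \<longlongrightarrow> 1) at_top"
      using nz by simp
  qed simp
qed

text \<open>By long-tailedness, unit steps eventually shrink the tail by a factor no smaller than
  \<open>exp (- l / 2)\<close>. At distance \<open>n\<close> the weight \<open>exp (l * n)\<close>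
  therefore outgrows the decay by \<open>exp (l / 2 * n)\<close>, which is unbounded.\<close>

lemma subexponential_heavy_tailed:
  assumes "F \<in> class_S"
  shows "F \<in> class_K"
  unfolding class_K_def
proof (safe intro!: in_distributions)
  fix l :: real assume l: "0 < l"
  let ?I = "\<integral>\<^sup>+y\<in>{0..}. ennreal (exp (l * y)) \<partial>F"
  have "\<forall>\<^sub>F x in at_top. tail F (x - 1) / tail F x < exp (l / 2)"
    using l by (intro order_tendstoD(2)[OF subexponential_long_tailed[OF assms]]) auto
  then obtain N0 where N0: "\<And>x. x \<ge> N0 \<Longrightarrow> tail F (x - 1) / tail F x < exp (l / 2)"
    by (auto simp: eventually_at_top_linorder)
  \<comment> \<open>The maximum with 0 keeps all points \<open>N + n\<close> in the range of
    integration and makes \<open>exp (l * n)\<close> at most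
    \<open>exp (l * (N + n))\<close>.\<close>
  define N where "N = max 0 N0"
  have step: "tail F (x - 1) \<le> exp (l / 2) * tail F x" if "N \<le> x" for x
    using N0[of x] that tail_pos[of x] by (simp add: N_def pos_divide_less_eq less_imp_le)
  have geom: "tail F N \<le> exp (l / 2 * real n) * tail F (N + real n)" for n
  proof (induction n)
    case (Suc n)
    have "tail F (N + real n) \<le> exp (l / 2) * tail F (N + real (Suc n))"
      using step[of "N + real (Suc n)"] by simp
    then have "exp (l / 2 * real n) * tail F (N + real n) \<le> exp (l / 2 * real n) * (exp (l / 2) * tail F (N + real (Suc n)))"
      by simp
    also have "\<dots> = exp (l / 2 * real (Suc n)) * tail F (N + real (Suc n))"
      by (simp add: exp_add[symmetric] algebra_simps add_divide_distrib)
    finally show ?case using Suc by simp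
  qed simp
  have le: "ennreal (exp (l / 2 * real n) * tail F N) \<le> ?I" for n
  proof -
    have "exp (l / 2 * real n) * tail F N \<le> exp (l / 2 * real n) * (exp (l / 2 * real n) * tail F (N + real n))"
      using geom[of n] by simp
    also have "\<dots> = exp (l * real n) * tail F (N + real n)"
      by (simp add: exp_add[symmetric] mult.assoc[symmetric])
    also have "\<dots> \<le> exp (l * (N + real n)) * tail F (N + real n)"
      using l tail_pos by (intro mult_right_mono) (auto simp: N_def less_imp_le)
    finally have "ennreal (exp (l / 2 * real n) * tail F N) \<le> ennreal (exp (l * (N + real n))) * ennreal (tail F (N + real n))"
      using tail_pos by (simp add: ennreal_mult[symmetric] less_imp_le ennreal_leI)
    also have "\<dots> = (\<integral>\<^sup>+y. ennreal (exp (l * (N + real n))) * indicator {N + real n<..} y \<partial>F)"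
      by (simp add: nn_integral_cmult emeasure_greaterThan)
    also have "\<dots> \<le> ?I"
      using l by (intro nn_integral_mono) (auto simp: N_def ennreal_leI split: split_indicator)
    finally show ?thesis .
  qed
  show "?I = \<infinity>"
  proof (rule ccontr)
    assume "?I \<noteq> \<infinity>"
    then obtain r where r: "0 \<le> r" "?I = ennreal r" by (cases ?I) auto
    have b: "exp (l / 2 * real n) * tail F N \<le> r" for n
      using le[of n] r by simp
    obtain n where n: "r / tail F N < real n * (l / 2)"
      using reals_Archimedean3[of "l / 2"] l by (meson half_gt_zero)
    also have "\<dots> \<le> exp (real n * (l / 2))"
      using exp_ge_add_one_self[of "real n * (l / 2)"] by linarith
    also have "\<dots> = exp (l / 2 * real n)"
      by (simp add: mult.commute)
    finally show False using b[of n] tail_pos[of N] by (simp add: pos_divide_less_eq)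
  qed
qed

text \<open>All other clauses of \<open>class_S_star\<close> hold, so the upper limit must differ
  from \<open>2 * mean F\<close>. Being at least that value, it is strictly larger.\<close>

lemma frequently_tail_product_gt:
  assumes "F \<in> class_S_f - class_S_star"
  obtains \<delta> where "0 < \<delta>"
    "\<exists>\<^sub>F x in at_top. (2 * mean F + \<delta>) * tail F x < (LBINT y:{0..x}. tail F (x - y) * tail F y)"
proof -
  let ?I = "\<lambda>x. LBINT y:{0..x}. tail F (x - y) * tail F y"
  let ?L = "Limsup at_top (\<lambda>x. ereal (1 / tail F x * ?I x))"
  have S: "F \<in> class_S" and fm: "finite_mean F" using assms by (auto simp: class_S_f_def)
  have ne: "?L \<noteq> ereal (2 * mean F)"
    using assms fm mean_pos[OF fm] subexponential_heavy_tailed[OF S] by (auto simp: class_S_star_def)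
  have "ereal (2 * mean F) \<le> ?L"
  proof -
    have "((\<lambda>x. ereal (2 * (LBINT y:{0..x / 2}. tail F y))) \<longlongrightarrow> ereal (2 * mean F)) at_top"
    proof (intro tendsto_ereal tendsto_mult tendsto_const)
      have "filterlim (\<lambda>x::real. x / 2) at_top at_top"
        using filterlim_tendsto_pos_mult_at_top[OF tendsto_const _ filterlim_ident, of "1/2::real"] by simp
      then show "((\<lambda>x. LBINT y:{0..x / 2}. tail F y) \<longlongrightarrow> mean F) at_top"
        by (rule filterlim_compose[OF set_integral_tail_tendsto_mean[OF fm]])
    qed
    then have "ereal (2 * mean F) = Limsup at_top (\<lambda>x. ereal (2 * (LBINT y:{0..x / 2}. tail F y)))"
      by (intro lim_imp_Limsup[symmetric]) auto
    also have "\<dots> \<le> ?L"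
    proof (rule Limsup_mono)
      show "\<forall>\<^sub>F x in at_top. ereal (2 * (LBINT y:{0..x / 2}. tail F y)) \<le> ereal (1 / tail F x * ?I x)"
        using eventually_ge_at_top[of 0]
      proof eventually_elim
        case (elim x)
        then show ?case
          using set_integral_tail_product_ge[of x] tail_pos[of x] by (simp add: pos_le_divide_eq ac_simps)
      qed
    qed
    finally show ?thesis .
  qed
  with ne have "ereal (2 * mean F) < ?L" by simp
  \<comment> \<open>The upper limit may be infinite; a real number strictly in between exists in
    either case, and its excess over \<open>2 * mean F\<close> serves as \<delta>.\<close>
  then obtain c where c: "ereal (2 * mean F) < ereal c" "ereal c < ?L"
    using ereal_dense2 by blast
  show thesis
  proof (rule that)
    show "0 < c - 2 * mean F" using c(1) by simp
    show "\<exists>\<^sub>F x in at_top. (2 * mean F + (c - 2 * mean F)) * tail F x < ?I x"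
    proof (rule ccontr)
      assume "\<not> ?thesis"
      then have "\<forall>\<^sub>F x in at_top. \<not> c * tail F x < ?I x" by (simp add: not_frequently)
      then have "\<forall>\<^sub>F x in at_top. ereal (1 / tail F x * ?I x) \<le> ereal c"
        by eventually_elim (use tail_pos in \<open>simp add: not_less pos_divide_le_eq\<close>)
      then have "?L \<le> ereal c" by (rule Limsup_bounded)
      with c(2) show False by simp
    qed
  qed
qed

section \<open>Upper bound for the conditional probability in the definition of J, for two
  summands\<close>

lemma cond_prob_max_given_sum_le:
  assumes "0 \<le> K"
  shows "cond_prob (\<Pi>\<^sub>M i\<in>{1..2::nat}. F) (\<lambda>X. Max (X ` {1..2}) > x - K) (\<lambda>X. (\<Sum>i=1..2. X i) > x)
    \<le> 1 - ((LINT y:{K<..x - K}|F. tail F (x - y)) - tail F (x - K) * tail F K) / tail (F \<star> F) x"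
proof -
  have eq: "{1..2} = {1, 2::nat}" by auto
  have Q: "prob {z. x < y + z} = tail F (x - y)" for y
    unfolding tail_eq_prob by (rule arg_cong[where f=prob]) auto
  have den: "measure (\<Pi>\<^sub>M i\<in>{1..2::nat}. F) {X \<in> space (\<Pi>\<^sub>M i\<in>{1..2::nat}. F). (\<Sum>i=1..2. X i) > x} = tail (F \<star> F) x"
    using prob_pair_eq[of "\<lambda>y z. x < y + z"] unfolding tail_eq_integral_conv Q eq by simp
  have dpos: "0 < tail (F \<star> F) x"
  proof -
    have "tail F x = (\<integral>y. tail F x \<partial>F)" using prob_space by simp
    also have "\<dots> \<le> (\<integral>y. tail F (x - y) \<partial>F)"
      using AE_nonneg tail_antimono tail_pos tail_le_1
      by (intro integral_mono_AE integrable_const_bound[of _ 1]) (auto simp: less_imp_le)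
    finally show ?thesis using tail_pos[of x] by (simp add: tail_eq_integral_conv)
  qed
  let ?P = "\<lambda>y z. x - K < max y z \<and> x < y + z"
  \<comment> \<open>For \<open>y\<close> in \<open>{K<..x - K}\<close> the maximum can exceed
    \<open>x - K\<close> only through \<open>z > x - K\<close>, and then \<open>y + z > x\<close> is
    automatic; the section thus has mass \<open>tail F (x - K)\<close>. Elsewhere the maximum
    condition is dropped.\<close>
  let ?g = "\<lambda>y. tail F (x - y) - indicator {K<..x - K} y * (tail F (x - y) - tail F (x - K))"
  have int1: "integrable F (\<lambda>y. tail F (x - y))"
    using set_integrable_tail_dist[of UNIV x] by (simp add: set_integrable_def)
  have int2: "integrable F (\<lambda>y. indicator {K<..x - K} y * (tail F (x - y) - tail F (x - K)))"
    using set_integrable_tail_dist[of "{K<..x - K}" x]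
    by (auto simp: set_integrable_def right_diff_distrib emeasure_eq_measure)
  have "measure (\<Pi>\<^sub>M i\<in>{1..2::nat}. F) {X \<in> space (\<Pi>\<^sub>M i\<in>{1..2::nat}. F). Max (X ` {1..2}) > x - K \<and> (\<Sum>i=1..2. X i) > x}
    = (\<integral>y. prob {z. ?P y z} \<partial>F)"
    using prob_pair_eq[of ?P] unfolding eq by simp
  also have "\<dots> \<le> (\<integral>y. ?g y \<partial>F)"
  proof (rule integral_mono')
    show "integrable F ?g" using int1 int2 by simp
    fix y
    have "prob {z. ?P y z} \<le> prob {z. x < y + z}" by (intro finite_measure_mono) auto
    moreover have "prob {z. ?P y z} = tail F (x - K)" if "y \<in> {K<..x - K}"
      unfolding tail_eq_prob using that by (intro arg_cong[where f=prob]) auto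
    ultimately show "prob {z. ?P y z} \<le> ?g y" unfolding Q by (auto split: split_indicator)
    then show "0 \<le> ?g y" using order_trans[OF measure_nonneg] by blast
  qed
  also have "\<dots> = tail (F \<star> F) x - (\<integral>y. indicator {K<..x - K} y * (tail F (x - y) - tail F (x - K)) \<partial>F)"
    using int1 int2 by (simp add: tail_eq_integral_conv)
  also have "(\<integral>y. indicator {K<..x - K} y * (tail F (x - y) - tail F (x - K)) \<partial>F)
     = (LINT y:{K<..x - K}|F. tail F (x - y)) - (LINT y:{K<..x - K}|F. tail F (x - K))"
    by (subst set_integral_diff(2)[symmetric])
      (auto simp: set_integrable_tail_dist, auto simp: set_integrable_def set_lebesgue_integral_def emeasure_eq_measure)
  also have "(LINT y:{K<..x - K}|F. tail F (x - K)) = tail F (x - K) * prob {K<..x - K}"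
    by (subst set_integral_const) (auto simp: emeasure_eq_measure)
  finally have num: "measure (\<Pi>\<^sub>M i\<in>{1..2::nat}. F) {X \<in> space (\<Pi>\<^sub>M i\<in>{1..2::nat}. F). Max (X ` {1..2}) > x - K \<and> (\<Sum>i=1..2. X i) > x}
    \<le> tail (F \<star> F) x - ((LINT y:{K<..x - K}|F. tail F (x - y)) - tail F (x - K) * prob {K<..x - K})" .
  have "prob {K<..x - K} \<le> tail F K" unfolding tail_eq_prob by (intro finite_measure_mono) auto
  then have "tail F (x - K) * prob {K<..x - K} \<le> tail F (x - K) * tail F K"
    using tail_pos[of "x - K"] by simp
  with num have le: "measure (\<Pi>\<^sub>M i\<in>{1..2::nat}. F) {X \<in> space (\<Pi>\<^sub>M i\<in>{1..2::nat}. F). Max (X ` {1..2}) > x - K \<and> (\<Sum>i=1..2. X i) > x}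
    \<le> tail (F \<star> F) x - ((LINT y:{K<..x - K}|F. tail F (x - y)) - tail F (x - K) * tail F K)" by linarith
  then show ?thesis
    unfolding cond_prob_def den
    using divide_right_mono[OF le less_imp_le[OF dpos]] dpos
    by (simp only: diff_divide_distrib[of "tail (F \<star> F) x"] divide_self less_imp_neq[symmetric] simp_thms)
qed

end

section \<open>The tilt violates the single-big-jump property\<close>

context exponential_tilt begin

text \<open>The preceding bound for \<open>G\<close>, expressed through \<open>F\<close>: the factor
  \<open>exp (- \<gamma> * x)\<close> cancels, the nonnegative \<open>F\<close>-integral over the
  middle range is discarded, and the Lebesgue integral there is estimated by
  \<open>set_integral_tail_product_le\<close> with \<open>a = K\<close>.\<close>

lemma cond_prob_max_given_sum_le_tilt:
  assumes "finite_mean F" "0 \<le> K" "2 * K \<le> x"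
  shows "cond_prob (\<Pi>\<^sub>M i\<in>{1..2::nat}. G) (\<lambda>X. Max (X ` {1..2}) > x - K) (\<lambda>X. (\<Sum>i=1..2. X i) > x)
    \<le> 1 - (\<gamma> * (LBINT y:{0..x}. tail F (x - y) * tail F y) - (2 * \<gamma> * mean F + tail F K) * tail F (x - K))
      / (tail F x + (LINT y:{0..x}|F. tail F (x - y)) + \<gamma> * (LBINT y:{0..x}. tail F (x - y) * tail F y))"
    (is "?cp \<le> 1 - (\<gamma> * ?I - ?r) / ?d")
proof -
  let ?J = "LBINT y:{K<..x - K}. tail F (x - y) * tail F y"
  let ?c = "exp (- \<gamma> * x)"
  have x: "0 \<le> x" "K \<le> x" using assms by auto
  have den: "tail (G \<star> G) x = ?c * ?d"
    using x by (simp add: G.tail_convolution set_integral_tilt tail_tilt algebra_simps)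
  have conv_nonneg: "0 \<le> (LINT y:A|F. tail F (x - y))" for A
    using F.tail_pos by (auto simp: set_lebesgue_integral_def less_imp_le intro!: integral_nonneg mult_nonneg_nonneg)
  have dpos: "0 < ?d"
    using F.tail_pos[of x] conv_nonneg[of "{0..x}"] F.set_integral_tail_product_nonneg[of "{0..x}" x] rate_pos
    by (intro add_pos_nonneg) auto
  have prod: "tail G (x - K) * tail G K = ?c * (tail F (x - K) * tail F K)"
    using x assms by (simp add: tail_tilt exp_add[symmetric] algebra_simps)
  have "?c * (\<gamma> * ?J - tail F (x - K) * tail F K) \<le> (LINT y:{K<..x - K}|G. tail G (x - y)) - tail G (x - K) * tail G K"
    using assms x conv_nonneg[of "{K<..x - K}"]
    by (subst set_integral_tilt) (auto simp: prod right_diff_distrib distrib_left subset_eq)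
  moreover have "\<gamma> * ?I - ?r \<le> \<gamma> * ?J - tail F (x - K) * tail F K"
    using mult_left_mono[OF F.set_integral_tail_product_le[OF assms] less_imp_le[OF rate_pos]]
    by (simp add: algebra_simps)
  ultimately have "?c * (\<gamma> * ?I - ?r) \<le> (LINT y:{K<..x - K}|G. tail G (x - y)) - tail G (x - K) * tail G K"
    by (meson exp_ge_zero mult_left_mono order_trans)
  then have "?c * (\<gamma> * ?I - ?r) / (?c * ?d) \<le> ((LINT y:{K<..x - K}|G. tail G (x - y)) - tail G (x - K) * tail G K) / tail (G \<star> G) x"
    unfolding den using dpos by (intro divide_right_mono) auto
  then show ?thesis
    using G.cond_prob_max_given_sum_le[OF assms(2), of x] by simp
qed

text \<open>The order of choices matters: \<open>c\<close> is fixed before \<open>K\<close>, so the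
  lower limits stay below 1 uniformly as \<open>K\<close> grows.\<close>

lemma frequently_cond_prob_le:
  assumes "F \<in> class_S_f - class_S_star"
  obtains c K0 where "0 < c" "\<And>K. K0 \<le> K \<Longrightarrow> \<exists>\<^sub>F x in at_top.
    cond_prob (\<Pi>\<^sub>M i\<in>{1..2::nat}. G) (\<lambda>X. Max (X ` {1..2}) > x - K) (\<lambda>X. (\<Sum>i=1..2. X i) > x) \<le> 1 - c"
proof -
  let ?I = "\<lambda>x. LBINT y:{0..x}. tail F (x - y) * tail F y"
  have S: "F \<in> class_S" and fm: "finite_mean F" using assms by (auto simp: class_S_f_def)
  obtain \<delta> where \<delta>: "0 < \<delta>" and freq: "\<exists>\<^sub>F x in at_top. (2 * mean F + \<delta>) * tail F x < ?I x"
    using F.frequently_tail_product_gt[OF assms] by blast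
  define m where "m = 2 * \<gamma> * mean F"
  \<comment> \<open>The gap \<open>\<gamma> * \<delta>\<close> equals \<open>2 * \<beta>\<close>:
    one \<beta> covers the losses from \<open>tail F K\<close> and from the shift by
    \<open>K\<close>, the other remains in the numerator.\<close>
  define \<beta> where "\<beta> = \<gamma> * \<delta> / 2"
  have \<beta>: "0 < \<beta>" using rate_pos \<delta> by (simp add: \<beta>_def)
  have m: "0 < m" using rate_pos F.mean_pos[OF fm] by (simp add: m_def)
  \<comment> \<open>In units of \<open>tail F x\<close>, when \<gamma> times the product integral is
    \<open>m + 2 * \<beta>\<close>, the numerator is at least \<beta> and the denominator at most
    \<open>m + 2 * \<beta> + 3\<close>. The 3 consists of 1 for the tail itself and 2 as an eventual
    bound for the convolution integral.\<close>
  define c where "c = \<beta> / (m + 2 * \<beta> + 3)"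
  have c: "0 < c" "c < 1" "c * (m + 2 * \<beta> + 3) = \<beta>" using \<beta> m by (simp_all add: c_def)
  obtain K0 where K0: "\<And>K. K0 \<le> K \<Longrightarrow> tail F K < \<beta> / 2"
    using order_tendstoD(2)[OF F.tail_tendsto_0, of "\<beta> / 2"] \<beta> by (auto simp: eventually_at_top_linorder)
  show thesis
  proof (rule that[OF c(1)])
    fix K assume K: "max 0 K0 \<le> K"
    then have FK: "tail F K < \<beta> / 2" and K_nonneg: "0 \<le> K" using K0 by auto
    \<comment> \<open>Chosen so that a shift costing less than the factor \<eta> raises
      \<open>m + \<beta> / 2\<close> to at most \<open>m + \<beta>\<close>. As \<eta> exceeds 1,
      long-tailedness provides this for large \<open>x\<close>.\<close>
    define \<eta> where "\<eta> = (m + \<beta>) / (m + \<beta> / 2)"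
    have \<eta>: "1 < \<eta>" "(m + \<beta> / 2) * \<eta> = m + \<beta>" using m \<beta> by (simp_all add: \<eta>_def)
    have "\<forall>\<^sub>F x in at_top. tail F (x - K) / tail F x < \<eta>"
      using \<eta>(1) by (intro order_tendstoD(2)[OF F.subexponential_long_tailed[OF S K_nonneg]])
    moreover have "\<forall>\<^sub>F x in at_top. (LINT y:{0..x}|F. tail F (x - y)) / tail F x < 2"
      by (intro order_tendstoD(2)[OF F.subexponential_convolution_tendsto[OF S]]) simp
    moreover have "\<forall>\<^sub>F x in at_top. 2 * K \<le> x" by (rule eventually_ge_at_top)
    ultimately have "\<forall>\<^sub>F x in at_top. tail F (x - K) / tail F x < \<eta> \<and>
        (LINT y:{0..x}|F. tail F (x - y)) / tail F x < 2 \<and> 2 * K \<le> x"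
      by eventually_elim blast
    from frequently_eventually_conj[OF freq this]
    show "\<exists>\<^sub>F x in at_top.
      cond_prob (\<Pi>\<^sub>M i\<in>{1..2::nat}. G) (\<lambda>X. Max (X ` {1..2}) > x - K) (\<lambda>X. (\<Sum>i=1..2. X i) > x) \<le> 1 - c"
    proof (rule frequently_elim1)
      fix x
      let ?a = "LINT y:{0..x}|F. tail F (x - y)"
      assume "(tail F (x - K) / tail F x < \<eta> \<and> ?a / tail F x < 2 \<and> 2 * K \<le> x) \<and>
        (2 * mean F + \<delta>) * tail F x < ?I x"
      then have I: "(2 * mean F + \<delta>) * tail F x < ?I x" and long: "tail F (x - K) < \<eta> * tail F x"
        and a: "?a < 2 * tail F x" and x: "2 * K \<le> x"
        using F.tail_pos[of x] by (simp_all add: pos_divide_less_eq)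
      let ?t = "tail F x"
      have t: "0 < ?t" by (rule F.tail_pos)
      have a_nonneg: "0 \<le> ?a"
        using F.tail_pos by (auto simp: set_lebesgue_integral_def less_imp_le intro!: integral_nonneg mult_nonneg_nonneg)
      have gI: "(m + 2 * \<beta>) * ?t \<le> \<gamma> * ?I x"
        using mult_strict_left_mono[OF I rate_pos] by (simp add: m_def \<beta>_def algebra_simps)
      have "(2 * \<gamma> * mean F + tail F K) * tail F (x - K) \<le> (m + \<beta> / 2) * (\<eta> * ?t)"
        using FK long m \<beta> F.tail_pos[of "x - K"] F.tail_pos[of K] by (intro mult_mono) (auto simp: m_def)
      also have "\<dots> = (m + \<beta>) * ?t" by (simp add: \<eta>(2) mult.assoc[symmetric])
      finally have r: "(2 * \<gamma> * mean F + tail F K) * tail F (x - K) \<le> (m + \<beta>) * ?t" .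
      have d: "0 < ?t + ?a + \<gamma> * ?I x"
        using t a_nonneg rate_pos F.set_integral_tail_product_nonneg[of "{0..x}" x]
        by (intro add_pos_nonneg) auto
      have "c * (?t + ?a + \<gamma> * ?I x) \<le> c * (3 * ?t + \<gamma> * ?I x)"
        using a c(1) by simp
      \<comment> \<open>Since \<open>1 - c\<close> is positive, a lower bound for the product
        integral suffices here; the integral may be arbitrarily large compared with the
        tail.\<close>
      also have "\<dots> = \<gamma> * ?I x + 3 * c * ?t - (1 - c) * (\<gamma> * ?I x)" by (simp add: algebra_simps)
      also have "\<dots> \<le> \<gamma> * ?I x + 3 * c * ?t - (1 - c) * ((m + 2 * \<beta>) * ?t)"
        using mult_left_mono[OF gI, of "1 - c"] c(2) by simp
      also have "\<dots> = \<gamma> * ?I x + (c * (m + 2 * \<beta> + 3) - (m + 2 * \<beta>)) * ?t" by (simp add: algebra_simps)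
      also have "\<dots> = \<gamma> * ?I x - (m + \<beta>) * ?t" unfolding c(3) by (simp add: algebra_simps)
      also have "\<dots> \<le> \<gamma> * ?I x - (2 * \<gamma> * mean F + tail F K) * tail F (x - K)" using r by simp
      finally have "c \<le> (\<gamma> * ?I x - (2 * \<gamma> * mean F + tail F K) * tail F (x - K)) / (?t + ?a + \<gamma> * ?I x)"
        using d by (simp add: pos_le_divide_eq)
      then show "cond_prob (\<Pi>\<^sub>M i\<in>{1..2::nat}. G) (\<lambda>X. Max (X ` {1..2}) > x - K) (\<lambda>X. (\<Sum>i=1..2. X i) > x) \<le> 1 - c"
        using cond_prob_max_given_sum_le_tilt[OF fm K_nonneg x] by linarith
    qed
  qed
qed

end

theorem proposition1p2:
  fixes \<gamma> :: real and F G :: "real measure"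
  assumes "\<gamma> > 0"
    and "F \<in> distributions"
    and "G \<in> distributions"
    and "\<And>x. x < 0 \<Longrightarrow> tail G x = 1"
    and "\<And>x. x \<ge> 0 \<Longrightarrow> tail G x = tail F x * exp (- \<gamma> * x)"
    and "F \<in> class_S_f - class_S_star"
  shows "G \<notin> class_J"
proof
  assume J: "G \<in> class_J"
  interpret F: real_distribution F using assms(2) by (simp add: distributions_iff)
  interpret G: real_distribution G using assms(3) by (simp add: distributions_iff)
  interpret exponential_tilt F G \<gamma>
    using assms(1-3,5) by unfold_locales auto
  let ?cp = "\<lambda>K x. cond_prob (\<Pi>\<^sub>M i\<in>{1..2::nat}. G) (\<lambda>X. Max (X ` {1..2}) > x - K) (\<lambda>X. (\<Sum>i=1..2. X i) > x)"
  obtain c K0 where c: "0 < c" and freq: "\<And>K. K0 \<le> K \<Longrightarrow> \<exists>\<^sub>F x in at_top. ?cp K x \<le> 1 - c"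
    using frequently_cond_prob_le[OF assms(6)] by blast
  \<comment> \<open>An upper bound at arbitrarily large \<open>x\<close> already bounds the lower
    limit.\<close>
  have "Liminf at_top (\<lambda>x. ereal (?cp K x)) \<le> ereal (1 - c)" if "K0 \<le> K" for K
  proof (rule ccontr)
    assume "\<not> ?thesis"
    then have "\<forall>\<^sub>F x in at_top. ereal (1 - c) < ereal (?cp K x)" by (intro less_LiminfD) simp
    then have "\<forall>\<^sub>F x in at_top. \<not> ?cp K x \<le> 1 - c" by eventually_elim simp
    then show False using freq[OF that] by (simp add: frequently_def)
  qed
  \<comment> \<open>The instance n = 2 of the defining condition of \<open>class_J\<close>.\<close>
  moreover have "((\<lambda>K. Liminf at_top (\<lambda>x. ereal (?cp K x))) \<longlongrightarrow> 1) at_top"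
    using J unfolding class_J_def by blast
  ultimately have "1 \<le> ereal (1 - c)"
    by (intro tendsto_upperbound[of "\<lambda>K. Liminf at_top (\<lambda>x. ereal (?cp K x))"])
      (auto intro: eventually_at_top_linorderI)
  then show False using c by (simp add: one_ereal_def)
qed

end
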